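(* Let $n\ge 2$, $I=[0,1]$, and let $\gamma:I\to\mathbb{R}^n$ be a twice-differentiable regular curve such that $\gamma(I)$ is not a subset of a line. Then for any set $X$ of lines in $\mathbb{R}^n$ with $\gamma(I)\subset\bigcup X$, the union $\bigcup X$ has Hausdorff dimension at least $2$.
   Context: A parametrized differentiable curve $\gamma$ is called regular if its derivative $\gamma'$ is nowhere zero. Twice-differentiable means that $\gamma''$ exists at every point of $I$ (one-sided at the endpoints); $\gamma''$ is not assumed continuous. *)

theory Defs
  imports "HOL-Analysis.Analysis"
begin

(* The contribution |U|^s of one covering set to the s-dimensional Hausdorff sum.  The case
   distinction is needed because 0 powr 0 = 0: a nonempty set always contributes 1 when s = 0
   (so the 0-dimensional measure is the counting measure), and the empty set contributes 0. *)
definition diam_pow :: "real \<Rightarrow> 'a::metric_space set \<Rightarrow> ennreal" where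
  "diam_pow s U =
     (if U = {} then 0 else if s = 0 then 1 else ennreal (diameter U powr s))"

(* Boundedness is required explicitly because the library's diameter is a real number and is
   unspecified on unbounded sets.  Finite covers are included by padding with empty sets. *)
definition delta_covers :: "real \<Rightarrow> 'a::metric_space set \<Rightarrow> (nat \<Rightarrow> 'a set) set" where
  "delta_covers d E =
     {U. E \<subseteq> (\<Union>i. U i) \<and> (\<forall>i. bounded (U i) \<and> diameter (U i) \<le> d)}"

definition hausdorff_premeasure :: "real \<Rightarrow> real \<Rightarrow> 'a::metric_space set \<Rightarrow> ennreal" where
  "hausdorff_premeasure d s E = (INF U \<in> delta_covers d E. \<Sum>i. diam_pow s (U i))"

definition hausdorff_measure :: "real \<Rightarrow> 'a::metric_space set \<Rightarrow> ennreal" where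
  "hausdorff_measure s E = (SUP d \<in> {0<..}. hausdorff_premeasure d s E)"

definition hausdorff_dim :: "'a::metric_space set \<Rightarrow> ennreal" where
  "hausdorff_dim E = Inf {ennreal s | s. 0 \<le> s \<and> hausdorff_measure s E = 0}"

definition is_line :: "'a::euclidean_space set \<Rightarrow> bool" where
  "is_line L \<longleftrightarrow> affine L \<and> aff_dim L = 1"

lemma is_line_iff_range:
  "is_line L \<longleftrightarrow> (\<exists>a v. v \<noteq> 0 \<and> L = range (\<lambda>t. a + t *\<^sub>R v))"
proof
  assume "is_line L"
  then have L: "affine L" "aff_dim L = 1" by (auto simp: is_line_def)
  then obtain B where B: "\<not> affine_dependent B" "affine hull B = L" "int (card B) = 2"
    using aff_dim_basis_exists[of L] affine_hull_eq[of L] by force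
  then have "card B = 2" by simp
  then obtain a b where ab: "B = {a, b}" "a \<noteq> b" by (auto simp: card_2_iff)
  have "L = range (\<lambda>t. a + t *\<^sub>R (b - a))"
    using B(2) ab(1) affine_hull_2_alt[of a b] by simp
  then show "\<exists>a v. v \<noteq> 0 \<and> L = range (\<lambda>t. a + t *\<^sub>R v)"
    using ab(2) by (metis right_minus_eq)
next
  assume "\<exists>a v. v \<noteq> 0 \<and> L = range (\<lambda>t. a + t *\<^sub>R v)"
  then obtain a v where v: "v \<noteq> 0" "L = range (\<lambda>t. a + t *\<^sub>R v)" by blast
  then have "L = affine hull {a, a + v}" by (simp add: affine_hull_2_alt)
  then show "is_line L" using v(1) by (simp add: is_line_def aff_dim_2)
qed

end

theory Submission imports Defs begin

text \<open>
  If \<open>\<gamma>''\<close> were parallel to \<open>\<gamma>'\<close> at almost every parameter, the unit tangent would have derivative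
  zero almost everywhere; being differentiable everywhere, it would be constant and \<open>\<gamma>\<close> would lie on
  a line (\<open>curve_in_line_if_accel_parallel_ae\<close>). So the curve bends on a set of parameters that is not
  negligible. Through each point \<open>\<gamma> t\<close> with such a parameter choose a line of the cover. On a smaller
  set \<open>K\<close>, still not negligible, these lines are all transversal to the curve or all tangent to it, and
  in both cases their intercepts and slopes, seen in suitable coordinates, satisfy
  \<open>max \<bar>\<Delta>intercept\<bar> \<bar>\<Delta>slope\<bar> \<ge> c * \<bar>t - t'\<bar>\<close>: the lines form a family that is one-dimensional in a
  quantitative sense.

  The union of such a family has dimension at least \<open>2\<close> by an energy argument in the spirit of
  Kaufman's projection theorem (\<open>line_family_cover_sum_lower_bound\<close>). For \<open>0 < r < 1\<close>, the
  energy of exponent \<open>r\<close> of the slice of the family at height \<open>x\<close>, integrated over \<open>x\<close>, is at most a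
  constant times the sum of \<open>\<bar>t - t'\<bar> powr (-r)\<close> over pairs of parameters, hence under control. By the mass
  distribution principle most slices cannot be covered by sets with small sum of \<open>d i powr r\<close>, and
  integration over the heights shows that the union itself cannot be covered by sets with small
  sum of \<open>d i powr (1 + r)\<close>. So its measure of every dimension below \<open>2\<close> is positive.

  The lines are chosen arbitrarily and may depend on \<open>t\<close> in a non-measurable way. The argument therefore
  uses outer measure, finite sets of separated parameters instead of measures on \<open>K\<close>, and a pointwise
  inequality between explicit integrable functions of the height.
\<close>

section \<open>Integrals and sums of truncated powers\<close>

lemma powr_add_le_add_powr:
  fixes a b r :: real
  assumes "0 \<le> a" "0 \<le> b" "0 < r" "r \<le> 1"
  shows "(a + b) powr r \<le> a powr r + b powr r"
proof (cases "a + b = 0")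
  case True
  then show ?thesis using assms by simp
next
  case False
  then have p: "a + b > 0" using assms by simp
  have le: "x \<le> x powr r" if "0 \<le> x" "x \<le> 1" for x :: real
    using powr_mono'[of r 1 x] that assms by auto
  have "1 = a / (a+b) + b / (a+b)" using p by (simp flip: add_divide_distrib)
  also have "\<dots> \<le> (a / (a+b)) powr r + (b / (a+b)) powr r"
    using p assms by (intro add_mono le) auto
  also have "\<dots> = (a powr r + b powr r) / (a + b) powr r"
    using p assms by (simp add: powr_divide add_divide_distrib)
  finally show ?thesis using p by (simp add: field_simps)
qed

text \<open>
  The singularity of \<open>\<bar>y\<bar> powr (-r)\<close> is integrable because \<open>r < 1\<close>: the primitive
  \<open>sgn y * \<bar>y\<bar> powr (1 - r) / (1 - r)\<close> is continuous across \<open>0\<close>, and the fundamental theorem of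
  calculus tolerates one point without a derivative. The arbitrary value \<open>b\<close> at the singular
  point lets the integrand dominate the truncated kernel there as well.
\<close>
lemma has_integral_abs_powr_affine:
  fixes u v r :: real
  assumes r: "0 < r" "r < 1" and v: "v \<noteq> 0"
  defines "F \<equiv> \<lambda>y::real. sgn y * \<bar>y\<bar> powr (1 - r) / (1 - r)"
  shows "((\<lambda>x. if u + x * v = 0 then b else \<bar>u + x * v\<bar> powr (- r))
           has_integral (F (u + v) / v - F u / v)) {0..1}"
proof -
  have cF: "continuous_on UNIV F"
  proof -
    have "F = (\<lambda>y. (max 0 y powr (1 - r) - max 0 (- y) powr (1 - r)) / (1 - r))"
      by (auto simp: F_def fun_eq_iff sgn_if max_def)
    then show ?thesis using r by (auto intro!: continuous_intros continuous_on_powr')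
  qed
  have dF: "(F has_real_derivative \<bar>y\<bar> powr (- r)) (at y)" if "y \<noteq> 0" for y
  proof (cases "y > 0")
    case True
    have "((\<lambda>y. y powr (1 - r) / (1 - r)) has_real_derivative y powr (-r)) (at y)"
      using True r by (auto intro!: derivative_eq_intros)
    moreover have "eventually (\<lambda>x. F x = x powr (1 - r) / (1 - r)) (nhds y)"
      by (rule eventually_mono[OF eventually_nhds_in_open[of "{0<..}" y]]) (use True in \<open>auto simp: F_def\<close>)
    ultimately show ?thesis using True by (simp add: DERIV_cong_ev)
  next
    case False
    with that have n: "y < 0" by simp
    have "((\<lambda>y. - ((- y) powr (1 - r) / (1 - r))) has_real_derivative (- y) powr (-r)) (at y)"
      using n r by (auto intro!: derivative_eq_intros)
    moreover have "eventually (\<lambda>x. F x = - ((- x) powr (1 - r) / (1 - r))) (nhds y)"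
      by (rule eventually_mono[OF eventually_nhds_in_open[of "{..<0}" y]]) (use n in \<open>auto simp: F_def\<close>)
    ultimately show ?thesis using n by (simp add: DERIV_cong_ev)
  qed
  define G where "G x = F (u + x * v) / v" for x
  have "((\<lambda>x. if u + x * v = 0 then b else \<bar>u + x * v\<bar> powr (- r))
           has_integral (G 1 - G 0)) {0..1}"
  proof (rule fundamental_theorem_of_calculus_strong[of "{- u / v}"])
    show "continuous_on {0..1} G"
      unfolding G_def using v
      by (intro continuous_intros continuous_on_compose2[OF cF]) auto
    fix x assume "x \<in> {0..1} - {- u / v}"
    then have nz: "u + x * v \<noteq> 0" using v by (auto simp: field_simps add_eq_0_iff)
    have "((\<lambda>x. F (u + x * v)) has_real_derivative (\<bar>u + x * v\<bar> powr (- r)) * v) (at x)"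
      by (rule DERIV_chain'[where g = F and f = "\<lambda>x. u + x * v", OF _ dF[OF nz]])
        (auto intro!: derivative_eq_intros)
    then have "(G has_real_derivative \<bar>u + x * v\<bar> powr (- r)) (at x)"
      unfolding G_def using v by (auto dest: DERIV_cdivide[where c = v])
    then show "(G has_vector_derivative (if u + x * v = 0 then b else \<bar>u + x * v\<bar> powr (- r))) (at x)"
      using nz by (simp add: has_real_derivative_iff_has_vector_derivative)
  qed auto
  then show ?thesis by (simp add: G_def)
qed

text \<open>
  The primitive is Hoelder continuous of exponent \<open>1 - r\<close>. This yields the full power
  \<open>\<bar>v\<bar> powr (-r)\<close>, uniformly in the truncation \<open>\<delta>\<close>; the weaker bound by a multiple of \<open>1 / \<bar>v\<bar>\<close>
  would make the energy below diverge logarithmically.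
\<close>
lemma integral_truncated_powr_affine_le:
  fixes u v r \<delta> :: real
  assumes r: "0 < r" "r < 1" and v: "v \<noteq> 0" and \<delta>: "\<delta> > 0"
  shows "integral {0..1} (\<lambda>x. max \<delta> \<bar>u + x * v\<bar> powr (- r)) \<le> 2 / (1 - r) * \<bar>v\<bar> powr (- r)"
proof -
  define F where "F \<equiv> \<lambda>y::real. sgn y * \<bar>y\<bar> powr (1 - r) / (1 - r)"
  have I: "((\<lambda>x. if u + x * v = 0 then \<delta> powr (-r) else \<bar>u + x * v\<bar> powr (- r))
           has_integral (F (u + v) / v - F u / v)) {0..1}"
    unfolding F_def by (rule has_integral_abs_powr_affine[OF r v])
  have "integral {0..1} (\<lambda>x. max \<delta> \<bar>u + x * v\<bar> powr (- r)) \<le> F (u + v) / v - F u / v"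
  proof (rule has_integral_le[OF integrable_integral I])
    show "(\<lambda>x. max \<delta> \<bar>u + x * v\<bar> powr - r) integrable_on {0..1}"
      using \<delta> by (intro integrable_continuous_real continuous_intros) auto
  qed (use r \<delta> in \<open>auto intro!: powr_mono2'\<close>)
  also have "\<dots> \<le> \<bar>F (u + v) - F u\<bar> / \<bar>v\<bar>"
    by (metis abs_divide abs_ge_self diff_divide_distrib)
  also have "\<bar>F (u + v) - F u\<bar> \<le> 2 * \<bar>v\<bar> powr (1 - r) / (1 - r)"
  proof -
    have *: "\<bar>sgn b * \<bar>b\<bar> powr (1 - r) - sgn a * \<bar>a\<bar> powr (1 - r)\<bar> \<le> 2 * \<bar>b - a\<bar> powr (1 - r)"
      if "a \<le> b" for a b :: real
    proof -
      have m: "x powr (1 - r) \<le> y powr (1 - r)" if "0 \<le> x" "x \<le> y" for x y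
        using that r by (intro powr_mono2) auto
      have p: "0 \<le> x powr (1 - r)" for x by simp
      consider "0 \<le> a" | "b \<le> 0" | "a < 0" "0 < b" using that by linarith
      then show ?thesis
      proof cases
        case 1
        then show ?thesis
          using that r powr_add_le_add_powr[of a "b - a" "1 - r"] m[of a b] p[of "b - a"]
          by (auto simp: sgn_if)
      next
        case 2
        then show ?thesis
          using that r powr_add_le_add_powr[of "- b" "b - a" "1 - r"] m[of "-b" "-a"] p[of "b - a"]
          by (auto simp: sgn_if)
      next
        case 3
        then show ?thesis using m[of b "b - a"] m[of "-a" "b - a"] by (auto simp: sgn_if)
      qed
    qed
    have "\<bar>sgn (u+v) * \<bar>u+v\<bar> powr (1 - r) - sgn u * \<bar>u\<bar> powr (1 - r)\<bar> \<le> 2 * \<bar>v\<bar> powr (1 - r)"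
      using *[of u "u + v"] *[of "u + v" u] by (cases "v \<ge> 0") auto
    then have "\<bar>sgn (u+v) * \<bar>u+v\<bar> powr (1 - r) - sgn u * \<bar>u\<bar> powr (1 - r)\<bar> / (1 - r)
      \<le> 2 * \<bar>v\<bar> powr (1 - r) / (1 - r)" using r by (intro divide_right_mono) auto
    moreover have "\<bar>F (u + v) - F u\<bar> =
      \<bar>sgn (u+v) * \<bar>u+v\<bar> powr (1 - r) - sgn u * \<bar>u\<bar> powr (1 - r)\<bar> / (1 - r)"
      using r by (simp add: F_def diff_divide_distrib[symmetric])
    ultimately show ?thesis by simp
  qed
  also have "2 * \<bar>v\<bar> powr (1 - r) / (1 - r) / \<bar>v\<bar> = 2 / (1 - r) * \<bar>v\<bar> powr (- r)"
    using v r by (simp add: powr_diff powr_minus field_simps)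
  finally show ?thesis by (simp add: divide_right_mono)
qed

text \<open>
  Here \<open>u\<close> and \<open>v\<close> are the differences of intercepts and of slopes of two lines, so that
  \<open>u + x * v\<close> is their separation at height \<open>x\<close>. If the slopes differ by at least \<open>\<tau> / 2\<close>, the lines
  are close only for few heights; otherwise the intercepts differ by at least \<open>\<tau>\<close> and the lines stay
  apart for all heights in the unit interval.
\<close>
lemma integral_truncated_powr_le:
  fixes u v r \<delta> \<tau> :: real
  assumes r: "0 < r" "r < 1" and \<delta>: "\<delta> > 0" and \<tau>: "0 < \<tau>" "\<tau> \<le> max \<bar>u\<bar> \<bar>v\<bar>"
  shows "integral {0..1} (\<lambda>x. max \<delta> \<bar>u + x * v\<bar> powr (- r)) \<le> 2 / (1 - r) * (\<tau> / 2) powr (- r)"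
proof (cases "\<tau> / 2 \<le> \<bar>v\<bar>")
  case True
  have "integral {0..1} (\<lambda>x. max \<delta> \<bar>u + x * v\<bar> powr (- r)) \<le> 2 / (1 - r) * \<bar>v\<bar> powr (- r)"
    using True \<tau> by (intro integral_truncated_powr_affine_le r \<delta>) auto
  also have "\<dots> \<le> 2 / (1 - r) * (\<tau> / 2) powr (- r)"
    using True \<tau> r by (intro mult_left_mono powr_mono2') auto
  finally show ?thesis .
next
  case False
  then have u: "\<tau> \<le> \<bar>u\<bar>" using \<tau> by (auto simp: max_def split: if_splits)
  have "integral {0..1} (\<lambda>x. max \<delta> \<bar>u + x * v\<bar> powr (- r)) \<le> integral {0..1} (\<lambda>x::real. (\<tau> / 2) powr (- r))"
  proof (rule integral_le)
    show "(\<lambda>x. max \<delta> \<bar>u + x * v\<bar> powr - r) integrable_on {0..1}"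
      using \<delta> by (intro integrable_continuous_real continuous_intros) auto
    fix x :: real assume x: "x \<in> {0..1}"
    have "\<bar>x * v\<bar> \<le> \<tau> / 2" using x False mult_mono[of "\<bar>x\<bar>" 1 "\<bar>v\<bar>" "\<tau>/2"] by (auto simp: abs_mult)
    then have "\<tau> / 2 \<le> \<bar>u + x * v\<bar>" using u by linarith
    then show "max \<delta> \<bar>u + x * v\<bar> powr - r \<le> (\<tau> / 2) powr (- r)"
      using \<tau> r by (intro powr_mono2') (auto simp: le_max_iff_disj)
  qed auto
  also have "\<dots> = 1 * (\<tau> / 2) powr (- r)" by simp
  also have "\<dots> \<le> 2 / (1 - r) * (\<tau> / 2) powr (- r)"
    using r by (intro mult_right_mono) auto
  finally show ?thesis .
qed

text \<open>
  Comparison of the sum with the integral of \<open>x powr (-r)\<close>, one mean value step per term.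
\<close>
lemma sum_powr_le:
  fixes r :: real
  assumes r: "0 < r" "r < 1"
  shows "(\<Sum>m=1..N. real m powr (- r)) \<le> real N powr (1 - r) / (1 - r)"
proof (induction N)
  case 0
  then show ?case by simp
next
  case (Suc N)
  have "real (Suc N) powr (- r) \<le> real (Suc N) powr (1 - r) / (1 - r) - real N powr (1 - r) / (1 - r)"
  proof (cases "N = 0")
    case True then show ?thesis using r by simp
  next
    case False
    have "\<exists>z::real. real N < z \<and> z < real (Suc N) \<and>
      real (Suc N) powr (1 - r) / (1 - r) - real N powr (1 - r) / (1 - r) = (real (Suc N) - real N) * z powr (-r)"
      using False r by (intro MVT2) (auto intro!: derivative_eq_intros)
    then obtain z where z: "real N < z" "z < real (Suc N)"
      "real (Suc N) powr (1 - r) / (1 - r) - real N powr (1 - r) / (1 - r) = z powr (-r)" by auto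
    then show ?thesis using r by (auto intro!: powr_mono2')
  qed
  then show ?case using Suc by simp
qed

text \<open>
  One row of a discrete energy. The indices stand for parameters lying in consecutive cells of
  length \<open>1 / N\<close>, so indices at distance \<open>h + 1\<close> guarantee only parameter distance \<open>h / N\<close>. The at
  most three indices next to \<open>j\<close> give no separation, and for them the truncation of the kernel
  supplies the bound \<open>N\<close>. As \<open>r < 1\<close>, all other terms together are of the order of \<open>N\<close> too.
\<close>
lemma energy_row_sum_le:
  fixes r B :: real and N :: nat and g :: "nat \<Rightarrow> real"
  assumes r: "0 < r" "r < 1" and J: "J \<subseteq> {..<N}" and B: "0 \<le> B"
    and near: "\<And>i. i \<in> J \<Longrightarrow> g i \<le> real N"
    and right: "\<And>i. i \<in> J \<Longrightarrow> j + 2 \<le> i \<Longrightarrow> g i \<le> B * (real (i - j - 1) / real N) powr (- r)"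
    and left: "\<And>i. i \<in> J \<Longrightarrow> i + 2 \<le> j \<Longrightarrow> g i \<le> B * (real (j - i - 1) / real N) powr (- r)"
    and jN: "j < N"
  shows "(\<Sum>i\<in>J. g i) \<le> (3 + 2 * B / (1 - r)) * real N"
proof -
  have fJ: "finite J" using J finite_subset by blast
  define J1 where "J1 = {i\<in>J. j \<le> i + 1 \<and> i \<le> j + 1}"
  define J2 where "J2 = {i\<in>J. j + 2 \<le> i}"
  define J3 where "J3 = {i\<in>J. i + 2 \<le> j}"
  have J123: "J = J1 \<union> (J2 \<union> J3)" by (auto simp: J1_def J2_def J3_def)
  have fin: "finite J1" "finite J2" "finite J3" using fJ by (auto simp: J1_def J2_def J3_def)
  have "J1 \<inter> (J2 \<union> J3) = {}" "J2 \<inter> J3 = {}" by (auto simp: J1_def J2_def J3_def)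
  then have eq: "(\<Sum>i\<in>J. g i) = (\<Sum>i\<in>J1. g i) + ((\<Sum>i\<in>J2. g i) + (\<Sum>i\<in>J3. g i))"
    unfolding J123 using fin by (simp add: sum.union_disjoint)
  have N0: "N > 0" using jN by simp
  have s1: "(\<Sum>i\<in>J1. g i) \<le> 3 * real N"
  proof -
    have "J1 \<subseteq> {j - 1..j + 1}" by (auto simp: J1_def)
    then have "card J1 \<le> card {j - 1..j + 1}" by (intro card_mono) auto
    then have "card J1 \<le> 3" by simp
    have "(\<Sum>i\<in>J1. g i) \<le> real (card J1) * real N"
      by (rule sum_bounded_above) (auto simp: J1_def near)
    also have "\<dots> \<le> 3 * real N" using \<open>card J1 \<le> 3\<close> N0 by (intro mult_right_mono) auto
    finally show ?thesis .
  qed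
  have tail: "(\<Sum>i\<in>A. g i) \<le> B / (1 - r) * real N"
    if h: "inj_on h A" "\<And>i. i \<in> A \<Longrightarrow> 1 \<le> h i \<and> h i \<le> N" "\<And>i. i \<in> A \<Longrightarrow> g i \<le> B * (real (h i) / real N) powr (- r)" for A h
  proof -
    have "(\<Sum>i\<in>A. g i) \<le> (\<Sum>i\<in>A. B * (real (h i) / real N) powr (- r))" by (intro sum_mono h)
    also have "\<dots> = (\<Sum>m\<in>h ` A. B * (real m / real N) powr (- r))" using h by (simp add: sum.reindex)
    also have "\<dots> \<le> (\<Sum>m=1..N. B * (real m / real N) powr (- r))"
      using h(2) B by (intro sum_mono2) auto
    also have "\<dots> = B * real N powr r * (\<Sum>m=1..N. real m powr (- r))"
      using N0 by (simp add: sum_distrib_left powr_divide powr_minus field_simps)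
    also have "\<dots> \<le> B * real N powr r * (real N powr (1 - r) / (1 - r))"
      using B by (intro mult_left_mono sum_powr_le r) auto
    also have "\<dots> = B / (1 - r) * (real N powr r * real N powr (1 - r))" by simp
    also have "real N powr r * real N powr (1 - r) = real N" using N0 by (simp flip: powr_add)
    finally show ?thesis .
  qed
  have s2: "(\<Sum>i\<in>J2. g i) \<le> B / (1 - r) * real N"
    by (rule tail[where h = "\<lambda>i. i - j - 1"]) (use J right in \<open>force simp: J2_def inj_on_def\<close>)+
  have s3: "(\<Sum>i\<in>J3. g i) \<le> B / (1 - r) * real N"
    by (rule tail[where h = "\<lambda>i. j - i - 1"]) (use jN left in \<open>force simp: J3_def inj_on_def\<close>)+
  have "(\<Sum>i\<in>J. g i) \<le> 3 * real N + (B / (1 - r) * real N + B / (1 - r) * real N)"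
    unfolding eq by (intro add_mono s1 s2 s3)
  also have "\<dots> = (3 + 2 * B / (1 - r)) * real N" by (simp add: algebra_simps)
  finally show ?thesis .
qed

section \<open>Mass distribution for separated families of lines\<close>

text \<open>
  The mass distribution principle for finitely many points, with \<open>Z j\<close> the set of those covering
  sets that contain the point \<open>j\<close>. A covering set of weight \<open>w\<close> which captures \<open>c\<close> points contributes
  at least \<open>c\<^sup>2 / w\<close> to the energy, and \<open>2 * c \<le> \<mu> * w + c\<^sup>2 / (\<mu> * w)\<close>. The free parameter \<open>\<mu>\<close>
  replaces the Cauchy--Schwarz inequality: the estimate is linear in both sums and can be integrated
  over a further variable, of which the individual \<open>c\<close> may be non-measurable functions.
\<close>
lemma card_le_cover_sum_plus_energy:
  fixes w :: "nat \<Rightarrow> real" and \<kappa> :: "'j \<Rightarrow> 'j \<Rightarrow> real" and Z :: "'j \<Rightarrow> nat set"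
  assumes J: "finite J" and I: "finite I"
    and cov: "\<And>j. j \<in> J \<Longrightarrow> \<exists>i\<in>I. i \<in> Z j"
    and w: "\<And>i. i \<in> I \<Longrightarrow> w i > 0" and \<kappa>0: "\<And>j j'. \<kappa> j j' \<ge> 0"
    and \<kappa>: "\<And>i j j'. \<lbrakk>i \<in> I; j \<in> J; j' \<in> J; i \<in> Z j; i \<in> Z j'\<rbrakk> \<Longrightarrow> 1 / w i \<le> \<kappa> j j'"
    and \<mu>: "\<mu> > 0"
  shows "2 * real (card J) \<le> \<mu> * (\<Sum>i\<in>{i\<in>I. \<exists>j\<in>J. i \<in> Z j}. w i) + (\<Sum>j\<in>J. \<Sum>j'\<in>J. \<kappa> j j') / \<mu>"
proof -
  obtain f where f: "\<And>j. j \<in> J \<Longrightarrow> f j \<in> I \<and> f j \<in> Z j" using cov by metis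
  define I' where "I' = {i\<in>I. \<exists>j\<in>J. i \<in> Z j}"
  have fI': "finite I'" using I by (simp add: I'_def)
  have fJ: "f ` J \<subseteq> I'" using f by (auto simp: I'_def)
  define C where "C i = {j\<in>J. f j = i}" for i
  have n: "real (card J) = (\<Sum>i\<in>I'. real (card (C i)))"
    using sum.group[OF J fI' fJ, of "\<lambda>_. 1 :: real"] by (simp add: C_def)
  have e: "(\<Sum>i\<in>I'. (real (card (C i)))\<^sup>2 / w i) \<le> (\<Sum>j\<in>J. \<Sum>j'\<in>J. \<kappa> j j')"
  proof -
    have "(\<Sum>i\<in>I'. (real (card (C i)))\<^sup>2 / w i) \<le> (\<Sum>i\<in>I'. \<Sum>j\<in>C i. \<Sum>j'\<in>J. \<kappa> j j')"
    proof (rule sum_mono)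
      fix i assume i: "i \<in> I'"
      have "(real (card (C i)))\<^sup>2 / w i = (\<Sum>j\<in>C i. \<Sum>j'\<in>C i. 1 / w i)"
        by (simp add: power2_eq_square)
      also have "\<dots> \<le> (\<Sum>j\<in>C i. \<Sum>j'\<in>C i. \<kappa> j j')"
      proof (intro sum_mono \<kappa>)
        have "j \<in> J \<and> i \<in> Z j" if "j \<in> C i" for j using f[of j] that by (auto simp: C_def)
        then show "j \<in> J" "i \<in> Z j" if "j \<in> C i" for j using that by auto
        then show "j \<in> J" "i \<in> Z j" if "j \<in> C i" for j using that by auto
      qed (use i in \<open>simp add: I'_def\<close>)
      also have "\<dots> \<le> (\<Sum>j\<in>C i. \<Sum>j'\<in>J. \<kappa> j j')"
        using J \<kappa>0 by (intro sum_mono sum_mono2) (auto simp: C_def)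
      finally show "(real (card (C i)))\<^sup>2 / w i \<le> (\<Sum>j\<in>C i. \<Sum>j'\<in>J. \<kappa> j j')" .
    qed
    also have "\<dots> = (\<Sum>j\<in>J. \<Sum>j'\<in>J. \<kappa> j j')"
      unfolding C_def by (rule sum.group[OF J fI' fJ])
    finally show ?thesis .
  qed
  have am: "2 * real (card (C i)) \<le> \<mu> * w i + (real (card (C i)))\<^sup>2 / w i / \<mu>" if "i \<in> I'" for i
  proof -
    define c where "c = real (card (C i))"
    have wi: "w i > 0" using that w by (auto simp: I'_def)
    have "0 \<le> (\<mu> * w i - c)\<^sup>2 / (\<mu> * w i)" using wi \<mu> by simp
    also have "\<dots> = \<mu> * w i + c\<^sup>2 / w i / \<mu> - 2 * c"
      using wi \<mu> by (simp add: field_simps power2_eq_square)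
    finally show ?thesis by (simp add: c_def)
  qed
  have "2 * real (card J) = (\<Sum>i\<in>I'. 2 * real (card (C i)))" by (simp add: n sum_distrib_left)
  also have "\<dots> \<le> (\<Sum>i\<in>I'. \<mu> * w i + (real (card (C i)))\<^sup>2 / w i / \<mu>)" by (intro sum_mono am)
  also have "\<dots> = \<mu> * (\<Sum>i\<in>I'. w i) + (\<Sum>i\<in>I'. (real (card (C i)))\<^sup>2 / w i) / \<mu>"
    by (simp add: sum.distrib sum_distrib_left sum_divide_distrib)
  also have "\<dots> \<le> \<mu> * (\<Sum>i\<in>I'. w i) + (\<Sum>j\<in>J. \<Sum>j'\<in>J. \<kappa> j j') / \<mu>"
    using e \<mu> by (simp add: divide_right_mono)
  finally show ?thesis unfolding I'_def .
qed

text \<open>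
  For an arbitrary set, outer measure is all that is needed to find many separated points: the
  cells that meet \<open>K\<close> cover it.
\<close>
lemma card_cells_ge:
  fixes K :: "real set"
  assumes K: "K \<subseteq> {0..1}" and m: "0 \<le> m" "ennreal m \<le> outer_measure_of lebesgue K" and N: "N > 0"
  shows "m * real N \<le> real (card {j\<in>{..<N}. K \<inter> {real j / real N .. (real j + 1) / real N} \<noteq> {}})"
proof -
  define I where "I j = {real j / real N .. (real j + 1) / real N}" for j
  define J where "J = {j\<in>{..<N}. K \<inter> I j \<noteq> {}}"
  have fJ: "finite J" by (simp add: J_def)
  have "K \<subseteq> (\<Union>j\<in>J. I j)"
  proof
    fix t assume t: "t \<in> K"
    then have t01: "0 \<le> t" "t \<le> 1" using K by auto
    have "\<exists>j<N. t \<in> I j"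
    proof (cases "t = 1")
      case True
      then show ?thesis using N by (intro exI[of _ "N - 1"]) (auto simp: I_def of_nat_diff)
    next
      case False
      let ?j = "nat \<lfloor>t * real N\<rfloor>"
      have j: "real ?j \<le> t * real N" "t * real N < real ?j + 1"
        using t01 N by (auto simp: of_nat_nat)
      have "t * real N < real N" using False t01 N by simp
      then have "?j < N" using j(1) by linarith
      then show ?thesis using j N by (intro exI[of _ ?j]) (auto simp: I_def field_simps)
    qed
    then show "t \<in> (\<Union>j\<in>J. I j)" using t by (auto simp: J_def)
  qed
  then have "outer_measure_of lebesgue K \<le> outer_measure_of lebesgue (\<Union>j\<in>J. I j)"
    by (rule outer_measure_of_mono)
  also have "\<dots> = emeasure lebesgue (\<Union>j\<in>J. I j)"
    using fJ by (intro outer_measure_of_eq sets.finite_UN) (auto simp: I_def)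
  also have "\<dots> \<le> (\<Sum>j\<in>J. emeasure lebesgue (I j))"
    using fJ by (intro emeasure_subadditive_finite) (auto simp: I_def)
  also have "\<dots> = (\<Sum>j\<in>J. ennreal (1 / real N))"
    using N by (intro sum.cong) (auto simp: I_def divide_right_mono diff_divide_distrib[symmetric])
  also have "\<dots> = ennreal (real (card J) / real N)"
    by (subst sum_ennreal) auto
  finally have "ennreal m \<le> ennreal (real (card J) / real N)" using m by order
  then have "m \<le> real (card J) / real N" by simp
  then show ?thesis using N by (simp add: J_def I_def field_simps)
qed

lemma nonnegligible_imp_outer_measure_pos:
  fixes K :: "'a::euclidean_space set"
  assumes "\<not> negligible K"
  shows "0 < outer_measure_of lebesgue K"
proof (rule ccontr)
  assume "\<not> ?thesis"
  then have z: "outer_measure_of lebesgue K = 0" by simp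
  obtain E where "E \<in> sets lebesgue" "K \<subseteq> E" "outer_measure_of lebesgue K = emeasure lebesgue E"
    using outer_measure_of_attain[of K lebesgue] by auto
  then have "E \<in> null_sets lebesgue" "K \<subseteq> E" using z by auto
  then show False using assms negligible_iff_null_sets negligible_subset by blast
qed

text \<open>
  The quantitative core. A line of the family meets the hyperplane at height \<open>x\<close> (in the direction
  \<open>k\<close>) in the point \<open>P t + x *\<^sub>R Q t\<close>, and the assumption \<open>sep\<close> says that different
  parameters give quantitatively different lines.

  A compact piece of each line is covered by finitely many of the sets, so for some \<open>n\<close> the
  first \<open>n\<close> sets already cover these pieces for a subset of \<open>K\<close> of large outer measure. There
  at least \<open>m * N\<close> parameters are chosen, one from each cell of length \<open>1 / N\<close> that is met, and for each height
  the mass distribution principle is applied to the slice. Integration over the height turns the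
  weights \<open>d i powr r\<close> of the slices into \<open>d i powr (1 + r)\<close>, because a set of diameter \<open>d i\<close> is
  met at heights from an interval of length at most \<open>2 * d i\<close>; and it makes the energy of order \<open>N\<^sup>2\<close>,
  because two separated lines are close to each other for few heights only.
\<close>
lemma line_family_cover_sum_lower_bound:
  fixes P Q :: "real \<Rightarrow> 'a::euclidean_space"
  assumes K: "K \<subseteq> {0..1}" "\<not> negligible K"
    and kl: "k \<in> Basis" "l \<in> Basis"
    and Pk: "\<And>t. t \<in> K \<Longrightarrow> P t \<bullet> k = 0" and Qk: "\<And>t. t \<in> K \<Longrightarrow> Q t \<bullet> k = 1"
    and c: "c > 0"
    and sep: "\<And>t t'. \<lbrakk>t \<in> K; t' \<in> K\<rbrakk> \<Longrightarrow>
       c * \<bar>t - t'\<bar> \<le> max \<bar>P t \<bullet> l - P t' \<bullet> l\<bar> \<bar>Q t \<bullet> l - Q t' \<bullet> l\<bar>"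
    and r: "0 < r" "r < 1"
  shows "\<exists>\<eta>>0. \<forall>V d. (\<forall>i::nat. open (V i) \<and> d i > 0 \<and> (\<forall>y\<in>V i. \<forall>z\<in>V i. dist y z \<le> d i)) \<longrightarrow>
     (\<forall>t\<in>K. \<forall>x\<in>{0..1}. P t + x *\<^sub>R Q t \<in> (\<Union>i. V i)) \<longrightarrow>
     (\<exists>n. \<eta> \<le> (\<Sum>i<n. d i powr (1 + r)))"
proof -
  obtain m' where m': "0 < m'" "m' < outer_measure_of lebesgue K"
    using nonnegligible_imp_outer_measure_pos[OF K(2)] dense by blast
  then obtain m where m: "m > 0" "ennreal m < outer_measure_of lebesgue K"
    by (cases m') (auto simp: ennreal_less_zero_iff)
  define B where "B = 2 / (1 - r) * (c / 2) powr (- r)"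
  define C where "C = 3 + 2 * B / (1 - r)"
  have B: "B \<ge> 0" using r by (simp add: B_def)
  have C: "C > 0" using B r unfolding C_def by (simp add: add_pos_nonneg)
  define \<eta> where "\<eta> = m\<^sup>2 / (4 * C)"
  have \<eta>: "\<eta> > 0" using m C by (simp add: \<eta>_def)
  show ?thesis
  proof (intro exI[of _ \<eta>] conjI allI impI \<eta>)
    fix V :: "nat \<Rightarrow> 'a set" and d
    assume Vd: "\<forall>i. open (V i) \<and> d i > 0 \<and> (\<forall>y\<in>V i. \<forall>z\<in>V i. dist y z \<le> d i)"
      and cov: "\<forall>t\<in>K. \<forall>x\<in>{0..1}. P t + x *\<^sub>R Q t \<in> (\<Union>i. V i)"
    have V: "open (V i)" and d: "d i > 0" for i using Vd by auto
    have dist: "dist y z \<le> d i" if "y \<in> V i" "z \<in> V i" for i y z using Vd that by blast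
    define f where "f t x = P t + x *\<^sub>R Q t" for t x
    define Kn where "Kn n = {t\<in>K. \<forall>x\<in>{0..1}. f t x \<in> (\<Union>i<n. V i)}" for n
    have "incseq Kn" unfolding incseq_def Kn_def by (force intro: order.strict_trans2)
    moreover have "(\<Union>n. Kn n) = K"
    proof
      show "K \<subseteq> (\<Union>n. Kn n)"
      proof
        fix t assume t: "t \<in> K"
        have "compact (f t ` {0..1})"
          unfolding f_def by (intro compact_continuous_image continuous_intros) auto
        moreover have "f t ` {0..1} \<subseteq> (\<Union>i\<in>UNIV. V i)" using cov t by (auto simp: f_def)
        ultimately obtain F where F: "finite F" "f t ` {0..1} \<subseteq> (\<Union>i\<in>F. V i)"
          using compactE_image[of "f t ` {0..1}" UNIV V] V by metis
        obtain n where "F \<subseteq> {..<n}" using F(1) finite_nat_iff_bounded by blast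
        then have "t \<in> Kn n" using F t by (fastforce simp: Kn_def)
        then show "t \<in> (\<Union>n. Kn n)" by blast
      qed
    qed (auto simp: Kn_def)
    ultimately have "(SUP n. outer_measure_of lebesgue (Kn n)) = outer_measure_of lebesgue K"
      using SUP_outer_measure_of_incseq[of Kn lebesgue] by simp
    then obtain n where n: "ennreal m < outer_measure_of lebesgue (Kn n)"
      using m(2) by (metis less_SUP_iff)
    \<comment> \<open>As \<open>\<delta> \<le> d i\<close>, the truncated kernel is still at least \<open>d i powr (-r)\<close> on pairs of points in \<open>V i\<close>.\<close>
    define \<delta> where "\<delta> = Min (insert 1 (d ` {..<n}))"
    have \<delta>: "\<delta> > 0" "\<And>i. i < n \<Longrightarrow> \<delta> \<le> d i" using d by (auto simp: \<delta>_def)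
    \<comment> \<open>The cells are so fine that the diagonal of the energy, at most \<open>N * \<delta> powr (-r)\<close>, is of order \<open>N\<^sup>2\<close>.\<close>
    obtain N0 where N0: "\<delta> powr (- r) \<le> real N0" using real_arch_simple by blast
    define N where "N = Suc N0"
    have N: "N > 0" "\<delta> powr (- r) \<le> real N" using N0 by (auto simp: N_def)
    define I where "I j = {real j / real N .. (real j + 1) / real N}" for j
    define J where "J = {j\<in>{..<N}. Kn n \<inter> I j \<noteq> {}}"
    have J: "finite J" "J \<subseteq> {..<N}" by (auto simp: J_def)
    have mN: "m * real N \<le> real (card J)"
      unfolding J_def I_def using K n m N by (intro card_cells_ge) (auto simp: Kn_def)
    have "\<forall>j\<in>J. \<exists>t. t \<in> Kn n \<inter> I j" by (auto simp: J_def)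
    then obtain \<tau> where \<tau>: "\<And>j. j \<in> J \<Longrightarrow> \<tau> j \<in> Kn n" "\<And>j. j \<in> J \<Longrightarrow> \<tau> j \<in> I j"
      by (metis IntD1 IntD2)
    have \<tau>K: "\<tau> j \<in> K" if "j \<in> J" for j using \<tau>(1)[OF that] by (simp add: Kn_def)
    define \<kappa> where "\<kappa> j j' x = max \<delta> \<bar>(P (\<tau> j) \<bullet> l - P (\<tau> j') \<bullet> l) + x * (Q (\<tau> j) \<bullet> l - Q (\<tau> j') \<bullet> l)\<bar> powr (- r)" for j j' x
    have \<kappa>int: "\<kappa> j j' integrable_on {0..1}" for j j'
      unfolding \<kappa>_def using \<delta> by (intro integrable_continuous_real continuous_intros) auto
    have near: "integral {0..1} (\<kappa> j j') \<le> real N" for j j'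
    proof -
      have "integral {0..1} (\<kappa> j j') \<le> integral {0..1} (\<lambda>x::real. \<delta> powr (- r))"
        using \<delta> r by (intro integral_le \<kappa>int) (auto simp: \<kappa>_def intro!: powr_mono2')
      then show ?thesis using N by simp
    qed
    have far: "integral {0..1} (\<kappa> j j') \<le> B * (h / real N) powr (- r)"
      if "j \<in> J" "j' \<in> J" "h > 0" "h / real N \<le> \<bar>\<tau> j - \<tau> j'\<bar>" for j j' h
    proof -
      have p: "c * (h / real N) > 0" using c that N by simp
      have "c * (h / real N) \<le> c * \<bar>\<tau> j - \<tau> j'\<bar>" using c that by (intro mult_left_mono) auto
      also have "\<dots> \<le> max \<bar>P (\<tau> j) \<bullet> l - P (\<tau> j') \<bullet> l\<bar> \<bar>Q (\<tau> j) \<bullet> l - Q (\<tau> j') \<bullet> l\<bar>"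
        using that by (intro sep \<tau>K)
      finally have "integral {0..1} (\<kappa> j j') \<le> 2 / (1 - r) * (c * (h / real N) / 2) powr (- r)"
        unfolding \<kappa>_def by (intro integral_truncated_powr_le r \<delta> p)
      also have "(c * (h / real N) / 2) powr (- r) = (c / 2) powr (- r) * (h / real N) powr (- r)"
        using c that(3) N by (subst powr_mult[symmetric]) (auto simp: field_simps)
      finally show ?thesis by (simp add: B_def)
    qed
    have gap: "real (j' - j - 1) / real N \<le> \<bar>\<tau> j - \<tau> j'\<bar>" if "j \<in> J" "j' \<in> J" "j + 2 \<le> j'" for j j'
    proof -
      have "\<tau> j \<le> (real j + 1) / real N" "real j' / real N \<le> \<tau> j'"
        using \<tau>(2)[OF that(1)] \<tau>(2)[OF that(2)] by (auto simp: I_def)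
      moreover have "real (j' - j - 1) / real N = real j' / real N - (real j + 1) / real N"
        using that by (simp add: of_nat_diff diff_divide_distrib add_divide_distrib)
      ultimately show ?thesis by linarith
    qed
    have energy: "(\<Sum>j\<in>J. \<Sum>j'\<in>J. integral {0..1} (\<kappa> j j')) \<le> C * (real N)\<^sup>2"
    proof -
      have "(\<Sum>j'\<in>J. integral {0..1} (\<kappa> j j')) \<le> C * real N" if j: "j \<in> J" for j
        unfolding C_def
      proof (rule energy_row_sum_le[OF r J(2) B near])
        show "j < N" using j J by auto
        show "integral {0..1} (\<kappa> j i) \<le> B * (real (i - j - 1) / real N) powr - r"
          if "i \<in> J" "j + 2 \<le> i" for i
          using gap[of j i] that j by (intro far) auto
        show "integral {0..1} (\<kappa> j i) \<le> B * (real (j - i - 1) / real N) powr - r"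
          if "i \<in> J" "i + 2 \<le> j" for i
          using gap[of i j] that j by (intro far) (auto simp: abs_minus_commute)
      qed
      then have "(\<Sum>j\<in>J. \<Sum>j'\<in>J. integral {0..1} (\<kappa> j j')) \<le> real (card J) * (C * real N)"
        by (rule sum_bounded_above)
      also have "\<dots> \<le> real N * (C * real N)"
        using card_mono[OF _ J(2)] C by (intro mult_right_mono) auto
      finally show ?thesis by (simp add: power2_eq_square mult_ac)
    qed
    \<comment> \<open>Only heights within \<open>d i\<close> of the height of one chosen point of \<open>V i\<close> can be met by \<open>V i\<close>.\<close>
    define a where "a i = (SOME z. z \<in> V i) \<bullet> k" for i
    define S where "S = (\<Sum>i<n. d i powr (1 + r))"
    \<comment> \<open>This choice makes the bound for the energy term equal to \<open>m * N\<close>, half of what has to be estimated.\<close>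
    define \<mu> where "\<mu> = C * real N / m"
    have \<mu>: "\<mu> > 0" using C N m by (simp add: \<mu>_def)
    define D where "D i x = (if x \<in> {a i - d i..a i + d i} then d i powr r else 0)" for i x
    have Dint: "D i integrable_on {0..1}" for i
      unfolding D_def integrable_restrict_Int Int_atLeastAtMost by (rule integrable_const_ivl)
    have DI: "integral {0..1} (D i) \<le> 2 * d i powr (1 + r)" for i
    proof -
      have "integral {0..1} (D i) = integral ({0..1} \<inter> {a i - d i..a i + d i}) (\<lambda>x. d i powr r)"
        unfolding D_def Henstock_Kurzweil_Integration.integral_restrict_Int by (simp only: Int_commute)
      also have "\<dots> \<le> (2 * d i) * d i powr r"
        using d[of i] by (auto simp: Int_atLeastAtMost max_def min_def intro!: mult_right_mono)
      also have "\<dots> = 2 * d i powr (1 + r)" using d[of i] by (simp add: powr_add)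
      finally show ?thesis .
    qed
    have pt: "2 * real (card J) \<le> \<mu> * (\<Sum>i<n. D i x) + (\<Sum>j\<in>J. \<Sum>j'\<in>J. \<kappa> j j' x) / \<mu>"
      if x: "x \<in> {0..1}" for x
    proof -
      let ?Z = "\<lambda>j. {i. f (\<tau> j) x \<in> V i}"
      have "2 * real (card J) \<le> \<mu> * (\<Sum>i\<in>{i\<in>{..<n}. \<exists>j\<in>J. i \<in> ?Z j}. d i powr r)
          + (\<Sum>j\<in>J. \<Sum>j'\<in>J. \<kappa> j j' x) / \<mu>"
      proof (rule card_le_cover_sum_plus_energy[OF J(1) _ _ _ _ _ \<mu>])
        fix j assume "j \<in> J"
        then have "\<tau> j \<in> Kn n" by (rule \<tau>)
        then show "\<exists>i\<in>{..<n}. i \<in> ?Z j" using x by (auto simp: Kn_def)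
      next
        fix i j j' assume a: "i \<in> {..<n}" "i \<in> ?Z j" "i \<in> ?Z j'"
        have "\<bar>(f (\<tau> j) x - f (\<tau> j') x) \<bullet> l\<bar> \<le> d i"
          using dist[of "f (\<tau> j) x" i "f (\<tau> j') x"] a Basis_le_norm[OF kl(2)]
          by (auto simp: dist_norm intro: order_trans)
        then have "max \<delta> \<bar>(P (\<tau> j) \<bullet> l - P (\<tau> j') \<bullet> l) + x * (Q (\<tau> j) \<bullet> l - Q (\<tau> j') \<bullet> l)\<bar> \<le> d i"
          using \<delta>(2)[of i] a(1) by (auto simp: f_def inner_diff_left inner_add_left algebra_simps)
        then have "d i powr (- r) \<le> \<kappa> j j' x"
          unfolding \<kappa>_def using \<delta> r by (intro powr_mono2') auto
        then show "1 / d i powr r \<le> \<kappa> j j' x" by (simp add: powr_minus_divide)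
      qed (use d in \<open>auto simp: \<kappa>_def less_imp_neq[symmetric]\<close>)
      also have "(\<Sum>i\<in>{i\<in>{..<n}. \<exists>j\<in>J. i \<in> ?Z j}. d i powr r) \<le> (\<Sum>i<n. D i x)"
      proof -
        have "x \<in> {a i - d i..a i + d i}" if "j \<in> J" "i \<in> ?Z j" for i j
        proof -
          have "(SOME z. z \<in> V i) \<in> V i" using that by (intro someI[of "\<lambda>z. z \<in> V i"]) auto
          then have "\<bar>(f (\<tau> j) x - (SOME z. z \<in> V i)) \<bullet> k\<bar> \<le> d i"
            using dist[of "f (\<tau> j) x" i "SOME z. z \<in> V i"] that Basis_le_norm[OF kl(1)]
            by (auto simp: dist_norm intro: order_trans)
          then show ?thesis
            using Pk[OF \<tau>K] Qk[OF \<tau>K] that(1)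
            by (auto simp: f_def inner_diff_left inner_add_left a_def)
        qed
        then have "(\<Sum>i\<in>{i\<in>{..<n}. \<exists>j\<in>J. i \<in> ?Z j}. d i powr r) = (\<Sum>i\<in>{i\<in>{..<n}. \<exists>j\<in>J. i \<in> ?Z j}. D i x)"
          unfolding D_def by (intro sum.cong) auto
        also have "\<dots> \<le> (\<Sum>i<n. D i x)" by (intro sum_mono2) (auto simp: D_def)
        finally show ?thesis .
      qed
      finally show ?thesis using \<mu> by simp
    qed
    have int_rhs: "((\<lambda>x. \<mu> * (\<Sum>i<n. D i x) + (\<Sum>j\<in>J. \<Sum>j'\<in>J. \<kappa> j j' x) / \<mu>) has_integral
       (\<mu> * (\<Sum>i<n. integral {0..1} (D i)) + (\<Sum>j\<in>J. \<Sum>j'\<in>J. integral {0..1} (\<kappa> j j')) / \<mu>)) {0..1}"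
      using J by (intro has_integral_add has_integral_mult_right has_integral_divide has_integral_sum
        integrable_integral Dint \<kappa>int) auto
    have "2 * real (card J) \<le> \<mu> * (\<Sum>i<n. integral {0..1} (D i)) + (\<Sum>j\<in>J. \<Sum>j'\<in>J. integral {0..1} (\<kappa> j j')) / \<mu>"
      by (rule has_integral_le[OF _ int_rhs pt]) (use has_integral_const_real[of "2 * real (card J)" 0 1] in auto)
    also have "\<dots> \<le> \<mu> * (2 * S) + C * (real N)\<^sup>2 / \<mu>"
    proof -
      have "(\<Sum>i<n. integral {0..1} (D i)) \<le> 2 * S"
        unfolding S_def sum_distrib_left by (intro sum_mono DI)
      then show ?thesis using \<mu> energy by (intro add_mono mult_left_mono divide_right_mono) auto
    qed
    also have "C * (real N)\<^sup>2 / \<mu> = m * real N" using C N m by (simp add: \<mu>_def power2_eq_square field_simps)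
    finally have "m * real N \<le> \<mu> * (2 * S)" using mN by linarith
    then have "m * (m * real N) \<le> m * (\<mu> * (2 * S))" using m by (intro mult_left_mono) auto
    also have "\<dots> = (m * \<mu>) * (2 * S)" by (simp only: mult.assoc)
    also have "m * \<mu> = C * real N" using m by (simp add: \<mu>_def)
    also have "C * real N * (2 * S) = real N * (2 * C * S)" by simp
    finally have "real N * m\<^sup>2 \<le> real N * (2 * C * S)" by (simp add: power2_eq_square mult_ac)
    then have "m\<^sup>2 \<le> 2 * C * S" using N by (subst (asm) mult_le_cancel_left_pos) auto
    also have "2 * C * S \<le> 4 * C * S"
      using C by (intro mult_right_mono) (auto simp: S_def sum_nonneg)
    also have "4 * C * S = S * (4 * C)" by (rule mult.commute)
    finally have "\<eta> \<le> S" unfolding \<eta>_def using C by (subst pos_divide_le_eq) auto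
    then show "\<exists>n. \<eta> \<le> (\<Sum>i<n. d i powr (1 + r))" unfolding S_def by blast
  qed
qed

section \<open>Dimension of unions of separated lines\<close>

text \<open>
  Covers by open sets with positive size bounds are easier to use than arbitrary ones: a slight
  fattening of each set costs at most a geometric series. Since the diameters are at most \<open>1\<close>, the
  exponent may be raised as well.
\<close>
lemma hausdorff_null_imp_small_open_cover:
  fixes E :: "'a::metric_space set"
  assumes null: "hausdorff_measure s E = 0" and s: "0 \<le> s" "s \<le> s'" "0 < s'" and \<epsilon>: "0 < \<epsilon>"
  shows "\<exists>(V :: nat \<Rightarrow> 'a set) d.
    (\<forall>i. open (V i) \<and> d i > 0 \<and> (\<forall>y\<in>V i. \<forall>z\<in>V i. dist y z \<le> d i)) \<and>
    E \<subseteq> (\<Union>i. V i) \<and> (\<forall>n. (\<Sum>i<n. d i powr s') < \<epsilon>)"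
proof -
  have "hausdorff_premeasure 1 s E \<le> hausdorff_measure s E"
    unfolding hausdorff_measure_def by (rule SUP_upper) simp
  then have "(INF U \<in> delta_covers 1 E. \<Sum>i. diam_pow s (U i)) < ennreal (\<epsilon> / 2)"
    using null \<epsilon> by (simp add: hausdorff_premeasure_def)
  then obtain U where U: "U \<in> delta_covers 1 E" "(\<Sum>i. diam_pow s (U i)) < ennreal (\<epsilon> / 2)"
    by (auto simp: INF_less_iff)
  then have cov: "E \<subseteq> (\<Union>i. U i)" and bd: "\<And>i. bounded (U i)" and d1: "\<And>i. diameter (U i) \<le> 1"
    by (auto simp: delta_covers_def)
  define D where "D i = diameter (U i)" for i
  have D0: "0 \<le> D i" for i unfolding D_def by (rule diameter_ge_0[OF bd])
  have DU: "ennreal (D i powr s') \<le> diam_pow s (U i)" for i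
  proof -
    have "D i powr s' \<le> D i powr s" if "s \<noteq> 0"
      using s D0[of i] d1[of i] that by (intro powr_mono') (auto simp: D_def)
    moreover have "D i powr s' \<le> 1" using powr_mono'[of 0 s' "D i"] s D0[of i] d1[of i]
      by (cases "D i = 0") (auto simp: D_def)
    moreover have "D i powr s' = 0" if "U i = {}" using that s by (simp add: D_def)
    ultimately show ?thesis using ennreal_leI[of "D i powr s'" 1] by (auto simp: diam_pow_def D_def ennreal_leI)
  qed
  have sumD: "(\<Sum>i<n. D i powr s') \<le> \<epsilon> / 2" for n
  proof -
    have "ennreal (\<Sum>i<n. D i powr s') = (\<Sum>i<n. ennreal (D i powr s'))"
      by (simp add: sum_ennreal)
    also have "\<dots> \<le> (\<Sum>i<n. diam_pow s (U i))" by (intro sum_mono DU)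
    also have "\<dots> \<le> (\<Sum>i. diam_pow s (U i))" by (intro sum_le_suminf) auto
    also have "\<dots> \<le> ennreal (\<epsilon> / 2)" using U by simp
    finally show ?thesis using \<epsilon> by (subst (asm) ennreal_le_iff) auto
  qed
  have "\<exists>h>0. (D i + 2 * h) powr s' < D i powr s' + \<epsilon> / 2 * (1 / 2) ^ Suc i" for i
  proof -
    have "((\<lambda>h. (D i + 2 * h) powr s') \<longlongrightarrow> (D i + 2 * 0) powr s') (at_right 0)"
    proof (rule tendsto_powr')
      show "D i + 2 * 0 \<noteq> 0 \<or> s' > 0 \<and> (\<forall>\<^sub>F h in at_right 0. 0 \<le> D i + 2 * h)"
        using s D0[of i] eventually_at_right_less[of "0::real"] by (auto elim!: eventually_mono)
    qed (intro tendsto_intros)+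
    then have "\<forall>\<^sub>F h in at_right 0. (D i + 2 * h) powr s' < D i powr s' + \<epsilon> / 2 * (1 / 2) ^ Suc i"
      using \<epsilon> by (intro order_tendstoD(2)) auto
    then have "\<forall>\<^sub>F h in at_right 0. h > 0 \<and> (D i + 2 * h) powr s' < D i powr s' + \<epsilon> / 2 * (1 / 2) ^ Suc i"
      by (intro eventually_conj eventually_at_right_less)
    then show ?thesis using eventually_happens'[OF trivial_limit_at_right_real] by blast
  qed
  then obtain h where h: "\<And>i. h i > 0"
    "\<And>i. (D i + 2 * h i) powr s' < D i powr s' + \<epsilon> / 2 * (1 / 2) ^ Suc i" by metis
  show ?thesis
  proof (intro exI[of _ "\<lambda>i. \<Union>x\<in>U i. ball x (h i)"] exI[of _ "\<lambda>i. D i + 2 * h i"] conjI allI ballI)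
    show "D i + 2 * h i > 0" for i using D0[of i] h(1)[of i] by linarith
    show "dist y z \<le> D i + 2 * h i"
      if yz: "y \<in> (\<Union>x\<in>U i. ball x (h i))" "z \<in> (\<Union>x\<in>U i. ball x (h i))" for i y z
    proof -
      obtain y' z' where "y' \<in> U i" "dist y' y < h i" "z' \<in> U i" "dist z' z < h i"
        using yz by auto
      moreover have "dist y' z' \<le> D i"
        unfolding D_def using calculation by (intro diameter_bounded_bound bd)
      moreover have "dist y z \<le> dist y' y + dist y' z' + dist z' z"
        using dist_triangle[of y z y'] dist_triangle[of y' z z'] by (simp add: dist_commute)
      ultimately show ?thesis by linarith
    qed
    have "U i \<subseteq> (\<Union>x\<in>U i. ball x (h i))" for i
    proof
      fix x assume "x \<in> U i"
      then show "x \<in> (\<Union>x\<in>U i. ball x (h i))" by (rule UN_I) (simp add: h(1))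
    qed
    then have "(\<Union>i. U i) \<subseteq> (\<Union>i. \<Union>x\<in>U i. ball x (h i))" by (rule UN_mono[OF order_refl])
    then show "E \<subseteq> (\<Union>i. \<Union>x\<in>U i. ball x (h i))" using cov by (rule order_trans[rotated])
    show "(\<Sum>i<n. (D i + 2 * h i) powr s') < \<epsilon>" for n
    proof -
      have geo: "(\<Sum>i<n. (1 / 2 :: real) ^ Suc i) = 1 - (1 / 2) ^ n"
        by (induction n) (auto simp: field_simps)
      have "(\<Sum>i<n. (D i + 2 * h i) powr s') \<le> (\<Sum>i<n. D i powr s' + \<epsilon> / 2 * (1 / 2) ^ Suc i)"
        using h(2) by (intro sum_mono less_imp_le) auto
      also have "\<dots> = (\<Sum>i<n. D i powr s') + \<epsilon> / 2 * (1 - (1 / 2) ^ n)"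
        by (simp only: sum.distrib sum_distrib_left[symmetric] geo)
      also have "\<dots> < \<epsilon> / 2 + \<epsilon> / 2 * 1" using \<epsilon> sumD[of n]
        by (intro add_le_less_mono mult_strict_left_mono) auto
      finally show ?thesis by simp
    qed
  qed auto
qed

lemma hausdorff_dim_separated_line_family_ge_2:
  fixes P Q :: "real \<Rightarrow> 'a::euclidean_space"
  assumes K: "K \<subseteq> {0..1}" "\<not> negligible K"
    and kl: "k \<in> Basis" "l \<in> Basis"
    and Pk: "\<And>t. t \<in> K \<Longrightarrow> P t \<bullet> k = 0" and Qk: "\<And>t. t \<in> K \<Longrightarrow> Q t \<bullet> k = 1"
    and c: "c > 0"
    and sep: "\<And>t t'. \<lbrakk>t \<in> K; t' \<in> K\<rbrakk> \<Longrightarrow>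
       c * \<bar>t - t'\<bar> \<le> max \<bar>P t \<bullet> l - P t' \<bullet> l\<bar> \<bar>Q t \<bullet> l - Q t' \<bullet> l\<bar>"
    and E: "\<And>t x. t \<in> K \<Longrightarrow> P t + x *\<^sub>R Q t \<in> E"
  shows "2 \<le> hausdorff_dim E"
  unfolding hausdorff_dim_def
proof (rule Inf_greatest)
  fix e assume "e \<in> {ennreal s | s. 0 \<le> s \<and> hausdorff_measure s E = 0}"
  then obtain s where s: "e = ennreal s" "0 \<le> s" "hausdorff_measure s E = 0" by auto
  have "2 \<le> s"
  proof (rule ccontr)
    assume "\<not> 2 \<le> s"
    \<comment> \<open>A null set for \<open>s\<close> is one for larger exponents; raising \<open>s\<close> to at least \<open>3/2\<close> gives \<open>0 < r\<close>.\<close>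
    define r where "r = max (1/2) (s - 1)"
    have r: "0 < r" "r < 1" "s \<le> 1 + r" "0 < 1 + r" using \<open>\<not> 2 \<le> s\<close> by (auto simp: r_def)
    obtain \<eta> where \<eta>: "\<eta> > 0"
      "\<And>V d. (\<forall>i::nat. open (V i) \<and> d i > 0 \<and> (\<forall>y\<in>V i. \<forall>z\<in>V i. dist y z \<le> d i)) \<Longrightarrow>
       (\<forall>t\<in>K. \<forall>x\<in>{0..1}. P t + x *\<^sub>R Q t \<in> (\<Union>i. V i)) \<Longrightarrow>
       (\<exists>n. \<eta> \<le> (\<Sum>i<n. d i powr (1 + r)))"
      using line_family_cover_sum_lower_bound[OF K kl Pk Qk c sep r(1,2)] by metis
    obtain V :: "nat \<Rightarrow> 'a set" and d where V:
      "\<forall>i. open (V i) \<and> d i > 0 \<and> (\<forall>y\<in>V i. \<forall>z\<in>V i. dist y z \<le> d i)"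
      "E \<subseteq> (\<Union>i. V i)" and small: "\<And>n. (\<Sum>i<n. d i powr (1 + r)) < \<eta>"
      using hausdorff_null_imp_small_open_cover[OF s(3,2) r(3,4) \<eta>(1)] by blast
    have "\<forall>t\<in>K. \<forall>x\<in>{0..1}. P t + x *\<^sub>R Q t \<in> (\<Union>i. V i)"
      using subsetD[OF V(2) E] by simp
    from \<eta>(2)[OF V(1) this] show False using small not_le by blast
  qed
  then show "2 \<le> e" using s(1) ennreal_leI[of 2 s] by simp
qed

section \<open>Bending curves\<close>

text \<open>
  The unit tangent is differentiable everywhere, and its derivative vanishes wherever \<open>\<gamma>''\<close> is
  parallel to \<open>\<gamma>'\<close>. As the Henstock--Kurzweil integral recovers a function from its derivative, however
  irregular, a derivative that vanishes outside a negligible set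
  makes the tangent direction constant. Existence of \<open>\<gamma>''\<close> at every point is essential: the tangent
  of a merely \<open>C\<^sup>1\<close> curve may turn like a Cantor function.
\<close>
lemma curve_in_line_if_accel_parallel_ae:
  fixes \<gamma> \<gamma>' \<gamma>'' :: "real \<Rightarrow> 'a::euclidean_space"
  assumes d1: "\<And>t. t \<in> {0..1} \<Longrightarrow> (\<gamma> has_vector_derivative \<gamma>' t) (at t within {0..1})"
    and d2: "\<And>t. t \<in> {0..1} \<Longrightarrow> (\<gamma>' has_vector_derivative \<gamma>'' t) (at t within {0..1})"
    and nz: "\<And>t. t \<in> {0..1} \<Longrightarrow> \<gamma>' t \<noteq> 0"
    and null: "negligible {t\<in>{0..1}. \<nexists>a. \<gamma>'' t = a *\<^sub>R \<gamma>' t}"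
  shows "\<exists>L. is_line L \<and> \<gamma> ` {0..1} \<subseteq> L"
proof -
  define \<phi> where "\<phi> t = 1 / sqrt (\<gamma>' t \<bullet> \<gamma>' t)" for t
  define \<phi>' where "\<phi>' t = - (\<gamma>' t \<bullet> \<gamma>'' t) / ((\<gamma>' t \<bullet> \<gamma>' t) * sqrt (\<gamma>' t \<bullet> \<gamma>' t))" for t
  define T where "T t = \<phi> t *\<^sub>R \<gamma>' t" for t
  have pos: "\<gamma>' t \<bullet> \<gamma>' t > 0" if "t \<in> {0..1}" for t using nz[OF that] by simp
  have d\<phi>: "(\<phi> has_real_derivative \<phi>' t) (at t within {0..1})" if t: "t \<in> {0..1}" for t
  proof -
    have "((\<lambda>t. \<gamma>' t \<bullet> \<gamma>' t) has_derivative (\<lambda>h. \<gamma>' t \<bullet> (h *\<^sub>R \<gamma>'' t) + (h *\<^sub>R \<gamma>'' t) \<bullet> \<gamma>' t)) (at t within {0..1})"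
      using d2[OF t] unfolding has_vector_derivative_def by (intro has_derivative_inner)
    then have dN: "((\<lambda>t. \<gamma>' t \<bullet> \<gamma>' t) has_real_derivative (2 * (\<gamma>' t \<bullet> \<gamma>'' t))) (at t within {0..1})"
      unfolding has_field_derivative_def
      by (rule has_derivative_eq_rhs) (simp add: fun_eq_iff inner_commute)
    have dS: "((\<lambda>x. 1 / sqrt x) has_real_derivative - 1 / (2 * y * sqrt y)) (at y)" if "y > 0" for y :: real
      using that by (auto intro!: derivative_eq_intros simp: field_simps)
    have "(\<phi> has_real_derivative
        - 1 / (2 * (\<gamma>' t \<bullet> \<gamma>' t) * sqrt (\<gamma>' t \<bullet> \<gamma>' t)) * (2 * (\<gamma>' t \<bullet> \<gamma>'' t))) (at t within {0..1})"
      unfolding \<phi>_def by (rule DERIV_chain2[OF dS[OF pos[OF t]] dN])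
    then show ?thesis by (simp add: \<phi>'_def)
  qed
  have dT: "(T has_vector_derivative (\<phi> t *\<^sub>R \<gamma>'' t + \<phi>' t *\<^sub>R \<gamma>' t)) (at t within {0..1})"
    if t: "t \<in> {0..1}" for t
    unfolding T_def by (rule has_vector_derivative_scaleR[OF d\<phi>[OF t] d2[OF t]])
  have T'0: "\<phi> t *\<^sub>R \<gamma>'' t + \<phi>' t *\<^sub>R \<gamma>' t = 0" if t: "t \<in> {0..1}" and "\<gamma>'' t = a *\<^sub>R \<gamma>' t" for t a
  proof -
    have "\<phi>' t = - a * \<phi> t" using pos[OF t] that(2) by (simp add: \<phi>_def \<phi>'_def)
    then show ?thesis using that(2) by simp
  qed
  have const: "T b = T 0" if b: "b \<in> {0..1}" for b
  proof -
    have "((\<lambda>t. \<phi> t *\<^sub>R \<gamma>'' t + \<phi>' t *\<^sub>R \<gamma>' t) has_integral (T b - T 0)) {0..b}"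
      using b by (intro fundamental_theorem_of_calculus has_vector_derivative_within_subset[OF dT]) auto
    moreover have "((\<lambda>t. \<phi> t *\<^sub>R \<gamma>'' t + \<phi>' t *\<^sub>R \<gamma>' t) has_integral 0) {0..b}"
    proof (rule has_integral_negligible[OF null])
      fix t assume t: "t \<in> {0..b} - {t \<in> {0..1}. \<nexists>a. \<gamma>'' t = a *\<^sub>R \<gamma>' t}"
      then have t01: "t \<in> {0..1}" using b by auto
      then obtain a where "\<gamma>'' t = a *\<^sub>R \<gamma>' t" using t by blast
      then show "\<phi> t *\<^sub>R \<gamma>'' t + \<phi>' t *\<^sub>R \<gamma>' t = 0" by (rule T'0[OF t01])
    qed
    ultimately have "T b - T 0 = 0" by (rule has_integral_unique)
    then show ?thesis by simp
  qed
  define e where "e = T 0"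
  have e1: "e \<bullet> e = 1" using pos[of 0] by (simp add: e_def T_def \<phi>_def)
  have \<gamma>'e: "\<gamma>' t = (\<gamma>' t \<bullet> e) *\<^sub>R e" if t: "t \<in> {0..1}" for t
  proof -
    have "\<phi> t *\<^sub>R \<gamma>' t = e" using const[OF t] by (simp add: T_def e_def)
    moreover have "\<phi> t \<noteq> 0" using pos[OF t] by (simp add: \<phi>_def)
    ultimately have "\<gamma>' t = (1 / \<phi> t) *\<^sub>R e" by auto
    then show ?thesis using e1 by simp
  qed
  have g: "\<gamma> b - (\<gamma> b \<bullet> e) *\<^sub>R e = \<gamma> 0 - (\<gamma> 0 \<bullet> e) *\<^sub>R e" if b: "b \<in> {0..1}" for b
  proof -
    have "((\<lambda>t. \<gamma> t - (\<gamma> t \<bullet> e) *\<^sub>R e) has_derivative (\<lambda>h. 0)) (at t within {0..1})" if t: "t \<in> {0..1}" for t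
    proof -
      have "((\<lambda>t. \<gamma> t - (\<gamma> t \<bullet> e) *\<^sub>R e) has_derivative
        (\<lambda>h. h *\<^sub>R \<gamma>' t - ((h *\<^sub>R \<gamma>' t) \<bullet> e) *\<^sub>R e)) (at t within {0..1})"
        using d1[OF t] unfolding has_vector_derivative_def by (auto intro!: derivative_eq_intros)
      moreover have "h *\<^sub>R \<gamma>' t - ((h *\<^sub>R \<gamma>' t) \<bullet> e) *\<^sub>R e = 0" for h
        using \<gamma>'e[OF t] by (metis eq_iff_diff_eq_0 inner_scaleR_left scaleR_scaleR)
      ultimately show ?thesis by simp
    qed
    then show ?thesis
      using has_derivative_zero_constant[of "{0..1::real}" "\<lambda>t. \<gamma> t - (\<gamma> t \<bullet> e) *\<^sub>R e"] b
      by (metis (no_types, lifting) atLeastAtMost_iff convex_real_interval(5) order_refl zero_le_one)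
  qed
  have "\<gamma> t = \<gamma> 0 + ((\<gamma> t - \<gamma> 0) \<bullet> e) *\<^sub>R e" if "t \<in> {0..1}" for t
    using g[OF that] by (simp add: inner_diff_left scaleR_diff_left algebra_simps)
  then have "\<gamma> ` {0..1} \<subseteq> range (\<lambda>s. \<gamma> 0 + s *\<^sub>R e)" by blast
  moreover have "is_line (range (\<lambda>s. \<gamma> 0 + s *\<^sub>R e))"
    unfolding is_line_iff_range using e1 by (metis inner_zero_left zero_neq_one)
  ultimately show ?thesis by blast
qed

lemma zero_with_nonzero_derivative_lower_bound:
  fixes h :: "real \<Rightarrow> real"
  assumes h: "(h has_real_derivative h') (at t within S)" and "h t = 0" "h' \<noteq> 0"
  shows "\<exists>e>0. \<forall>t'\<in>S. \<bar>t' - t\<bar> < e \<longrightarrow> e * \<bar>t' - t\<bar> \<le> \<bar>h t'\<bar>"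
proof -
  have "((\<lambda>y. (h y - h t) / (y - t)) \<longlongrightarrow> h') (at t within S)"
    using h by (simp add: has_field_derivative_iff)
  then have "\<forall>\<^sub>F y in at t within S. dist ((h y - h t) / (y - t)) h' < \<bar>h'\<bar> / 2"
    using assms(3) by (intro tendstoD) auto
  then obtain d where d: "d > 0" "\<And>y. y \<in> S \<Longrightarrow> y \<noteq> t \<Longrightarrow> dist y t < d \<Longrightarrow> dist (h y / (y - t)) h' < \<bar>h'\<bar> / 2"
    using assms(2) unfolding eventually_at by auto
  show ?thesis
  proof (intro exI[of _ "min d (\<bar>h'\<bar> / 2)"] conjI ballI impI)
    fix t' assume t': "t' \<in> S" "\<bar>t' - t\<bar> < min d (\<bar>h'\<bar> / 2)"
    show "min d (\<bar>h'\<bar> / 2) * \<bar>t' - t\<bar> \<le> \<bar>h t'\<bar>"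
    proof (cases "t' = t")
      case False
      have "\<bar>h t' / (t' - t) - h'\<bar> < \<bar>h'\<bar> / 2" using d(2)[OF t'(1) False] t' by (simp add: dist_real_def)
      then have "\<bar>h'\<bar> / 2 \<le> \<bar>h t' / (t' - t)\<bar>" by linarith
      then have "\<bar>h'\<bar> / 2 * \<bar>t' - t\<bar> \<le> \<bar>h t'\<bar>" using False by (simp add: abs_divide field_simps)
      moreover have "min d (\<bar>h'\<bar> / 2) * \<bar>t' - t\<bar> \<le> \<bar>h'\<bar> / 2 * \<bar>t' - t\<bar>" by (intro mult_right_mono) auto
      ultimately show ?thesis by linarith
    qed simp
  qed (use d assms in auto)
qed

text \<open>
  A countable pigeonhole. Near each \<open>t\<close> some \<open>F i t\<close> grows at least linearly in the distance from
  \<open>t\<close>, with index, rate and radius depending on \<open>t\<close>. Sorting by the index, by some \<open>m\<close>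
  for which \<open>1 / Suc m\<close> is below both rate and radius, and by cells of length \<open>1 / Suc m\<close> gives countably many
  classes, on each of which the growth is uniform and valid for all pairs.
\<close>
lemma nonnegligible_uniform_separation:
  fixes D :: "real set" and F :: "'i \<Rightarrow> real \<Rightarrow> real \<Rightarrow> real"
  assumes D: "\<not> negligible D" and I: "countable I"
    and loc: "\<And>t. t \<in> D \<Longrightarrow> \<exists>i\<in>I. A i t \<and>
       (\<exists>e>0. \<forall>t'\<in>D. A i t' \<longrightarrow> \<bar>t' - t\<bar> < e \<longrightarrow> e * \<bar>t' - t\<bar> \<le> F i t t')"
  shows "\<exists>i\<in>I. \<exists>c>0. \<exists>K\<subseteq>D. \<not> negligible K \<and> (\<forall>t\<in>K. A i t) \<and> (\<forall>t\<in>K. \<forall>t'\<in>K. c * \<bar>t' - t\<bar> \<le> F i t t')"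
proof -
  define K where "K = (\<lambda>(i, m, q). {t\<in>D. A i t \<and> \<lfloor>t * real (Suc m)\<rfloor> = q \<and>
    (\<forall>t'\<in>D. A i t' \<longrightarrow> \<bar>t' - t\<bar> < 1 / real (Suc m) \<longrightarrow> 1 / real (Suc m) * \<bar>t' - t\<bar> \<le> F i t t')})"
  define Ind where "Ind = I \<times> (UNIV :: nat set) \<times> (UNIV :: int set)"
  have "D \<subseteq> \<Union>(K ` Ind)"
  proof
    fix t assume t: "t \<in> D"
    obtain i e where i: "i \<in> I" "A i t" "e > 0"
      "\<And>t'. t' \<in> D \<Longrightarrow> A i t' \<Longrightarrow> \<bar>t' - t\<bar> < e \<Longrightarrow> e * \<bar>t' - t\<bar> \<le> F i t t'"
      using loc[OF t] by blast
    obtain m where m: "1 / real (Suc m) < e" using nat_approx_posE[OF i(3)] by metis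
    have "1 / real (Suc m) * \<bar>t' - t\<bar> \<le> F i t t'"
      if "t' \<in> D" "A i t'" "\<bar>t' - t\<bar> < 1 / real (Suc m)" for t'
    proof -
      have "1 / real (Suc m) * \<bar>t' - t\<bar> \<le> e * \<bar>t' - t\<bar>" using m by (intro mult_right_mono) auto
      then show ?thesis using i(4)[OF that(1,2)] that(3) m by linarith
    qed
    then have "t \<in> K (i, m, \<lfloor>t * real (Suc m)\<rfloor>)" using t i(2) by (simp add: K_def del: of_nat_Suc)
    then show "t \<in> \<Union>(K ` Ind)" using i(1) by (auto simp: Ind_def)
  qed
  then have "\<not> negligible (\<Union>(K ` Ind))" using D negligible_subset by blast
  moreover have "countable (K ` Ind)" using I by (simp add: Ind_def)
  ultimately obtain S where "S \<in> K ` Ind" "\<not> negligible S"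
    by (meson negligible_countable_Union)
  then obtain i m q where K: "i \<in> I" "\<not> negligible (K (i, m, q))"
    by (auto simp: Ind_def)
  show ?thesis
  proof (intro bexI[OF _ K(1)] exI[of _ "1 / real (Suc m)"] exI[of _ "K (i, m, q)"] conjI ballI)
    fix t t' assume t: "t \<in> K (i, m, q)" "t' \<in> K (i, m, q)"
    then have "\<lfloor>t * real (Suc m)\<rfloor> = \<lfloor>t' * real (Suc m)\<rfloor>" by (simp add: K_def del: of_nat_Suc)
    then have "\<bar>t' * real (Suc m) - t * real (Suc m)\<bar> < 1"
      using floor_correct[of "t * real (Suc m)"] floor_correct[of "t' * real (Suc m)"] by linarith
    then have "\<bar>t' - t\<bar> * real (Suc m) < 1" by (simp add: left_diff_distrib[symmetric] abs_mult del: of_nat_Suc)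
    then have "\<bar>t' - t\<bar> < 1 / real (Suc m)" by (simp add: field_simps del: of_nat_Suc)
    then show "1 / real (Suc m) * \<bar>t' - t\<bar> \<le> F i t t'" using t by (simp add: K_def del: of_nat_Suc)
  next
    show "K (i, m, q) \<subseteq> D" by (auto simp: K_def)
    show "\<not> negligible (K (i, m, q))" by (rule K(2))
    show "A i t" if "t \<in> K (i, m, q)" for t using that by (simp add: K_def)
  qed simp
qed

lemma parallel_by_coordinates:
  fixes a b :: "'a::euclidean_space"
  assumes "k \<in> Basis" "b \<bullet> k \<noteq> 0" "\<And>l. l \<in> Basis \<Longrightarrow> (a \<bullet> l) * (b \<bullet> k) = (b \<bullet> l) * (a \<bullet> k)"
  shows "a = ((a \<bullet> k) / (b \<bullet> k)) *\<^sub>R b"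
proof (rule euclidean_eqI)
  fix l :: 'a assume "l \<in> Basis"
  then have "a \<bullet> l = (b \<bullet> l) * (a \<bullet> k) / (b \<bullet> k)"
    using assms(2) assms(3)[of l] by (metis nonzero_mult_div_cancel_right)
  then show "a \<bullet> l = ((a \<bullet> k) / (b \<bullet> k)) *\<^sub>R b \<bullet> l" by simp
qed

section \<open>Covering a curve by lines\<close>

text \<open>
  For each parameter where \<open>\<gamma>''\<close> is not parallel to \<open>\<gamma>'\<close>, one line of the cover through \<open>\<gamma> t\<close> is
  fixed, and \<open>P k t\<close>, \<open>Q k t\<close> describe it as a graph over the coordinate axis \<open>k\<close>. Nearby chosen lines
  are separated for one of two reasons. If the line at \<open>t\<close> is transversal to the curve, then \<open>\<gamma> t'\<close>,
  which lies on the line at \<open>t'\<close>, has distance of order \<open>\<bar>t' - t\<bar>\<close> from the line at \<open>t\<close>. If both lines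
  are tangents, their slopes differ at that order, because the slope of the tangent has a nonzero
  derivative at \<open>t\<close>. Either way a single coordinate \<open>l\<close> sees the separation.
\<close>
theorem hausdorff_dim_line_cover_of_curve_ge_2:
  fixes \<gamma> \<gamma>' \<gamma>'' :: "real \<Rightarrow> 'a::euclidean_space"
    and X :: "'a set set"
  assumes d1: "\<And>t. t \<in> {0..1} \<Longrightarrow> (\<gamma> has_vector_derivative \<gamma>' t) (at t within {0..1})"
    and d2: "\<And>t. t \<in> {0..1} \<Longrightarrow> (\<gamma>' has_vector_derivative \<gamma>'' t) (at t within {0..1})"
    and nz: "\<And>t. t \<in> {0..1} \<Longrightarrow> \<gamma>' t \<noteq> 0"
    and noline: "\<not> (\<exists>L. is_line L \<and> \<gamma> ` {0..1} \<subseteq> L)"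
    and X: "\<forall>L \<in> X. is_line L"
    and cov: "\<gamma> ` {0..1} \<subseteq> \<Union>X"
  shows "hausdorff_dim (\<Union>X) \<ge> 2"
proof -
  define D where "D = {t\<in>{0..1}. \<nexists>a. \<gamma>'' t = a *\<^sub>R \<gamma>' t}"
  have D: "\<not> negligible D"
    unfolding D_def using curve_in_line_if_accel_parallel_ae[OF d1 d2 nz] noline by blast
  have D01: "t \<in> {0..1}" if "t \<in> D" for t using that by (simp add: D_def)
  have "\<exists>v. v \<noteq> 0 \<and> (\<forall>s. \<gamma> t + s *\<^sub>R v \<in> \<Union>X)" if t: "t \<in> {0..1}" for t
  proof -
    obtain L where L: "L \<in> X" "\<gamma> t \<in> L" using cov t by blast
    then obtain a v where av: "v \<noteq> 0" "L = range (\<lambda>s. a + s *\<^sub>R v)" using X is_line_iff_range by blast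
    then obtain s0 where s0: "\<gamma> t = a + s0 *\<^sub>R v" using L by blast
    have "\<gamma> t + s *\<^sub>R v = a + (s0 + s) *\<^sub>R v" for s by (simp add: s0 algebra_simps)
    then have "\<gamma> t + s *\<^sub>R v \<in> L" for s using av(2) by blast
    then show ?thesis using av L by blast
  qed
  then obtain v where v0: "\<And>t. t \<in> {0..1} \<Longrightarrow> v t \<noteq> 0"
    and vX: "\<And>t s. t \<in> {0..1} \<Longrightarrow> \<gamma> t + s *\<^sub>R v t \<in> \<Union>X" by metis
  define tangent where "tangent t \<longleftrightarrow> (\<exists>a. \<gamma>' t = a *\<^sub>R v t)" for t
  define Q where "Q k t = (1 / (v t \<bullet> k)) *\<^sub>R v t" for k t
  define P where "P k t = \<gamma> t - (\<gamma> t \<bullet> k) *\<^sub>R Q k t" for k t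
  have "continuous_on {0..1} \<gamma>"
    using d1 by (meson continuous_on_eq_continuous_within has_vector_derivative_continuous)
  then have "bounded (\<gamma> ` {0..1})" by (intro compact_imp_bounded compact_continuous_image) auto
  then obtain R where R: "R > 0" "\<And>t. t \<in> {0..1} \<Longrightarrow> norm (\<gamma> t) \<le> R"
    by (auto simp: bounded_pos)
  define A where "A = (\<lambda>(b, k, l :: 'a) t. (tangent t \<longleftrightarrow> b) \<and> v t \<bullet> k \<noteq> 0)"
  define F where "F = (\<lambda>(b::bool, k, l) t t'. max \<bar>P k t' \<bullet> l - P k t \<bullet> l\<bar> \<bar>Q k t' \<bullet> l - Q k t \<bullet> l\<bar>)"
  define Ind where "Ind = (UNIV :: bool set) \<times> (Basis :: 'a set) \<times> (Basis :: 'a set)"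
  have "\<exists>i\<in>Ind. A i t \<and> (\<exists>e>0. \<forall>t'\<in>D. A i t' \<longrightarrow> \<bar>t' - t\<bar> < e \<longrightarrow> e * \<bar>t' - t\<bar> \<le> F i t t')"
    if t: "t \<in> D" for t
  proof -
    note t01 = D01[OF t]
    obtain k where k: "k \<in> Basis" "v t \<bullet> k \<noteq> 0" using v0[OF t01] euclidean_all_zero_iff by blast
    have comp: "((\<lambda>t. f t \<bullet> l) has_real_derivative f' \<bullet> l) (at t within {0..1})"
      if "(f has_vector_derivative f') (at t within {0..1})" for f f' and l :: 'a
      using bounded_linear.has_vector_derivative[OF bounded_linear_inner_left that]
      by (simp add: has_real_derivative_iff_has_vector_derivative)
    show ?thesis
    proof (cases "tangent t")
      case False
      have Qk: "Q k t \<bullet> k = 1" using k by (simp add: Q_def)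
      have "\<exists>l\<in>Basis. \<gamma>' t \<bullet> l - (\<gamma>' t \<bullet> k) * (Q k t \<bullet> l) \<noteq> 0"
      proof (rule ccontr)
        assume *: "\<not> ?thesis"
        have "\<gamma>' t = (\<gamma>' t \<bullet> k) *\<^sub>R Q k t"
        proof (rule euclidean_eqI)
          fix l :: 'a assume "l \<in> Basis"
          then have "\<gamma>' t \<bullet> l - (\<gamma>' t \<bullet> k) * (Q k t \<bullet> l) = 0" using * by blast
          then show "\<gamma>' t \<bullet> l = ((\<gamma>' t \<bullet> k) *\<^sub>R Q k t) \<bullet> l" unfolding inner_scaleR_left by linarith
        qed
        then have "\<gamma>' t = ((\<gamma>' t \<bullet> k) * (1 / (v t \<bullet> k))) *\<^sub>R v t" unfolding Q_def scaleR_scaleR .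
        then have "tangent t" unfolding tangent_def by (rule exI)
        with False show False by contradiction
      qed
      then obtain l where l: "l \<in> Basis" "\<gamma>' t \<bullet> l - (\<gamma>' t \<bullet> k) * (Q k t \<bullet> l) \<noteq> 0" by blast
      \<comment> \<open>The offset of \<open>\<gamma> t'\<close> from the line at \<open>t\<close>, measured in the coordinate \<open>l\<close>.\<close>
      define h where "h t' = \<gamma> t' \<bullet> l - (P k t \<bullet> l + (\<gamma> t' \<bullet> k) * (Q k t \<bullet> l))" for t'
      have "(h has_real_derivative (\<gamma>' t \<bullet> l - (\<gamma>' t \<bullet> k) * (Q k t \<bullet> l))) (at t within {0..1})"
        unfolding h_def by (auto intro!: derivative_eq_intros comp d1 t01)
      moreover have "h t = 0" by (simp add: h_def P_def inner_diff_left)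
      ultimately obtain e where e: "e > 0"
        "\<And>t'. t' \<in> {0..1} \<Longrightarrow> \<bar>t' - t\<bar> < e \<Longrightarrow> e * \<bar>t' - t\<bar> \<le> \<bar>h t'\<bar>"
        using zero_with_nonzero_derivative_lower_bound[OF _ _ l(2)] by blast
      \<comment> \<open>The separation occurs at height \<open>\<gamma> t' \<bullet> k\<close>, so a bound \<open>R\<close> for these heights passes it on to intercept or slope.\<close>
      define c where "c = e / (1 + R)"
      have c: "c > 0" "c \<le> e" "c * (1 + R) = e" using R e(1) by (auto simp: c_def field_simps)
      have "c * \<bar>t' - t\<bar> \<le> F (False, k, l) t t'"
        if t': "t' \<in> D" "A (False, k, l) t'" "\<bar>t' - t\<bar> < c" for t'
      proof -
        note t'01 = D01[OF t'(1)]
        define M where "M = F (False, k, l) t t'"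
        have "h t' = (P k t' \<bullet> l - P k t \<bullet> l) + (\<gamma> t' \<bullet> k) * (Q k t' \<bullet> l - Q k t \<bullet> l)"
          by (simp add: h_def P_def inner_diff_left algebra_simps)
        then have "\<bar>h t'\<bar> \<le> \<bar>P k t' \<bullet> l - P k t \<bullet> l\<bar> + \<bar>\<gamma> t' \<bullet> k\<bar> * \<bar>Q k t' \<bullet> l - Q k t \<bullet> l\<bar>"
          by (metis abs_mult abs_triangle_ineq)
        also have "\<dots> \<le> M + R * M"
          using R(2)[OF t'01] Basis_le_norm[OF k(1), of "\<gamma> t'"] R(1)
          by (intro add_mono mult_mono) (auto simp: M_def F_def)
        finally have "e * \<bar>t' - t\<bar> \<le> (1 + R) * M"
          using e(2)[OF t'01] t'(3) c(2) by (simp add: algebra_simps)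
        then show ?thesis using R(1) by (simp add: c_def M_def field_simps)
      qed
      then show ?thesis using False k l c(1)
        by (intro bexI[of _ "(False, k, l)"]) (auto simp: A_def Ind_def)
    next
      case True
      have Qtan: "Q k t' = (1 / (\<gamma>' t' \<bullet> k)) *\<^sub>R \<gamma>' t' \<and> \<gamma>' t' \<bullet> k \<noteq> 0"
        if t': "tangent t'" "t' \<in> {0..1}" "v t' \<bullet> k \<noteq> 0" for t'
      proof -
        obtain a where a: "\<gamma>' t' = a *\<^sub>R v t'" using t'(1) by (auto simp: tangent_def)
        then have "a \<noteq> 0" using nz[OF t'(2)] by auto
        then show ?thesis using t'(3) by (simp add: Q_def a)
      qed
      have Qt: "Q k t = (1 / (\<gamma>' t \<bullet> k)) *\<^sub>R \<gamma>' t" "\<gamma>' t \<bullet> k \<noteq> 0"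
        using Qtan[OF True t01 k(2)] by auto
      have "\<exists>l\<in>Basis. (\<gamma>'' t \<bullet> l) * (\<gamma>' t \<bullet> k) \<noteq> (\<gamma>' t \<bullet> l) * (\<gamma>'' t \<bullet> k)"
        using parallel_by_coordinates[OF k(1) Qt(2), of "\<gamma>'' t"] t unfolding D_def by blast
      then obtain l where l: "l \<in> Basis" "(\<gamma>'' t \<bullet> l) * (\<gamma>' t \<bullet> k) \<noteq> (\<gamma>' t \<bullet> l) * (\<gamma>'' t \<bullet> k)" by blast
      \<comment> \<open>The slope of the tangent at \<open>t'\<close> relative to that at \<open>t\<close>.\<close>
      define h where "h t' = (\<gamma>' t' \<bullet> l) / (\<gamma>' t' \<bullet> k) - Q k t \<bullet> l" for t'
      let ?h' = "((\<gamma>'' t \<bullet> l) * (\<gamma>' t \<bullet> k) - (\<gamma>' t \<bullet> l) * (\<gamma>'' t \<bullet> k)) / ((\<gamma>' t \<bullet> k) * (\<gamma>' t \<bullet> k))"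
      have "(h has_real_derivative ?h' - 0) (at t within {0..1})"
        unfolding h_def by (intro DERIV_diff DERIV_divide comp d2 t01 DERIV_const Qt(2))
      moreover have "h t = 0" by (simp add: h_def Qt(1))
      moreover have "?h' - 0 \<noteq> 0" using l Qt(2) by simp
      ultimately obtain e where e: "e > 0"
        "\<And>t'. t' \<in> {0..1} \<Longrightarrow> \<bar>t' - t\<bar> < e \<Longrightarrow> e * \<bar>t' - t\<bar> \<le> \<bar>h t'\<bar>"
        using zero_with_nonzero_derivative_lower_bound by blast
      have "e * \<bar>t' - t\<bar> \<le> F (True, k, l) t t'"
        if t': "t' \<in> D" "A (True, k, l) t'" "\<bar>t' - t\<bar> < e" for t'
      proof -
        have "Q k t' = (1 / (\<gamma>' t' \<bullet> k)) *\<^sub>R \<gamma>' t'"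
          using Qtan[OF _ D01[OF t'(1)]] t'(2) by (auto simp: A_def)
        then have "h t' = Q k t' \<bullet> l - Q k t \<bullet> l" by (simp add: h_def)
        then have "\<bar>h t'\<bar> \<le> F (True, k, l) t t'" by (simp add: F_def)
        then show ?thesis using e(2)[OF D01[OF t'(1)] t'(3)] by linarith
      qed
      then show ?thesis using True k l e(1)
        by (intro bexI[of _ "(True, k, l)"]) (auto simp: A_def Ind_def)
    qed
  qed
  moreover have "countable Ind" by (simp add: Ind_def countable_finite)
  ultimately obtain i c K where i: "i \<in> Ind" and c: "c > 0" and K: "K \<subseteq> D" "\<not> negligible K"
    and KA: "\<forall>t\<in>K. A i t" and sep: "\<forall>t\<in>K. \<forall>t'\<in>K. c * \<bar>t' - t\<bar> \<le> F i t t'"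
    using nonnegligible_uniform_separation[OF D, of Ind A F] by metis
  obtain b k l where bkl: "i = (b, k, l)" "k \<in> Basis" "l \<in> Basis" using i by (auto simp: Ind_def)
  have vk: "v t \<bullet> k \<noteq> 0" if "t \<in> K" for t using KA that by (auto simp: A_def bkl)
  show ?thesis
  proof (rule hausdorff_dim_separated_line_family_ge_2[OF _ K(2) bkl(2,3) _ _ c, of "P k" "Q k"])
    show "K \<subseteq> {0..1}" using K(1) D01 by blast
    show Qk: "Q k t \<bullet> k = 1" if "t \<in> K" for t using vk[OF that] by (simp add: Q_def)
    show "P k t \<bullet> k = 0" if "t \<in> K" for t using Qk[OF that] by (simp add: P_def inner_diff_left)
    show "c * \<bar>t - t'\<bar> \<le> max \<bar>P k t \<bullet> l - P k t' \<bullet> l\<bar> \<bar>Q k t \<bullet> l - Q k t' \<bullet> l\<bar>"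
      if "t \<in> K" "t' \<in> K" for t t'
      using sep that by (simp add: F_def bkl)
    show "P k t + x *\<^sub>R Q k t \<in> \<Union>X" if "t \<in> K" for t x
    proof -
      have "P k t + x *\<^sub>R Q k t = \<gamma> t + ((x - \<gamma> t \<bullet> k) / (v t \<bullet> k)) *\<^sub>R v t"
        by (simp add: P_def Q_def algebra_simps diff_divide_distrib)
      then show ?thesis using vX[of t] that K(1) D01 by (metis subsetD)
    qed
  qed
qed

theorem corollary2p9:
  fixes \<gamma> \<gamma>' \<gamma>'' :: "real \<Rightarrow> real ^ 'n"
    and X :: "(real ^ 'n) set set"
  assumes "CARD('n) \<ge> 2"
    and "\<And>t. t \<in> {0..1} \<Longrightarrow> (\<gamma> has_vector_derivative \<gamma>' t) (at t within {0..1})"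
    and "\<And>t. t \<in> {0..1} \<Longrightarrow> (\<gamma>' has_vector_derivative \<gamma>'' t) (at t within {0..1})"
    and "\<And>t. t \<in> {0..1} \<Longrightarrow> \<gamma>' t \<noteq> 0"
    and "\<not> (\<exists>L. is_line L \<and> \<gamma> ` {0..1} \<subseteq> L)"
    and "\<forall>L \<in> X. is_line L"
    and "\<gamma> ` {0..1} \<subseteq> \<Union>X"
  shows "hausdorff_dim (\<Union>X) \<ge> 2"
  by (rule hausdorff_dim_line_cover_of_curve_ge_2[OF assms(2-7)])

end
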